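(* Let $T$ be a tree with at least two vertices. Then $T^{[\sharp 2]}$ consists of exactly two connected components, each of which is a clique tree.
   Context: All graphs are finite and simple. For a graph $H=(V,E)$, its exact-distance square $H^{[\sharp 2]}$ is the graph with vertex set $V$ in which distinct vertices $x,y$ are adjacent if and only if their distance in $H$ is exactly $2$. A block of a graph is a maximal subgraph without cut-vertices. A clique tree is a connected graph each of whose blocks is a complete graph. *)

theory Defs
  imports "Graph_Theory.Graph_Theory"
begin

text \<open>
  Finite simple graphs are the symmetric digraphs of the locale \<open>graph\<close> (finite, no loops, no
  parallel arcs): an edge is a pair of opposite arcs. Two points need care in this encoding:
  the connected components of such a graph are its \<open>sccs\<close>, and the library's \<open>forest\<close>/\<open>tree\<close>
  cannot be used, since every edge gives a digraph cycle of length 2.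
\<close>

text \<open>The cycles of length at least 3 are exactly the cycles of the undirected graph.\<close>

definition undirected_tree :: "('a,'b) pre_digraph \<Rightarrow> bool" where
  "undirected_tree G \<longleftrightarrow> graph G \<and> connected G \<and>
     \<not> (\<exists>p. pre_digraph.cycle G p \<and> 3 \<le> length p)"

text \<open>
  With unit weights \<open>\<mu>\<close> is the least length of a walk, and it is \<open>\<infinity>\<close> if there is none.
  It is specified for \<open>wf_digraph\<close>s only.
\<close>

definition graph_dist :: "('a,'b) pre_digraph \<Rightarrow> 'a \<Rightarrow> 'a \<Rightarrow> ereal" where
  "graph_dist G x y = wf_digraph.\<mu> G (\<lambda>_. 1) x y"

definition exact_dist_square :: "('a,'b) pre_digraph \<Rightarrow> 'a pair_pre_digraph" where
  "exact_dist_square H =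
     \<lparr> pverts = verts H,
       parcs = {(x, y). x \<in> verts H \<and> y \<in> verts H \<and> x \<noteq> y \<and> graph_dist H x y = 2} \<rparr>"

definition cut_vertex :: "('a,'b) pre_digraph \<Rightarrow> 'a \<Rightarrow> bool" where
  "cut_vertex G v \<longleftrightarrow> v \<in> verts G \<and>
     card (pre_digraph.sccs (pre_digraph.del_vert G v)) > card (pre_digraph.sccs G)"

text \<open>
  Blocks are connected, as usual: otherwise two disjoint edges of a path on four vertices would
  form a block. The conjunct \<open>graph H\<close> is needed because \<open>subgraph\<close> also admits
  subdigraphs that contain only one of the two arcs of an edge.
\<close>

definition block :: "('a,'b) pre_digraph \<Rightarrow> ('a,'b) pre_digraph \<Rightarrow> bool" where
  "block B G \<longleftrightarrow>
     pre_digraph.max_subgraph G (\<lambda>H. graph H \<and> connected H \<and> \<not> (\<exists>v. cut_vertex H v)) B"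

definition clique_tree :: "('a,'b) pre_digraph \<Rightarrow> bool" where
  "clique_tree G \<longleftrightarrow> graph G \<and> connected G \<and> (\<forall>B. block B G \<longrightarrow> (\<exists>n. K\<^bsub>n\<^esub> B))"

end

theory Submission
  imports Defs
begin

text \<open>
  A tree has no odd closed walk, so distinct vertices are at distance \<open>2\<close> iff they have a common
  neighbour; the components of the square are then the two colour classes of the bipartition.

  For the blocks, suppose \<open>u x y\<close> is a path in the square with \<open>u, y\<close> not adjacent there. Common
  neighbours \<open>a\<close> of \<open>u, x\<close> and \<open>b\<close> of \<open>x, y\<close> are distinct. A path of the square from \<open>u\<close> to \<open>y\<close>
  avoiding \<open>x\<close> expands to a walk of the tree from \<open>a\<close> to \<open>b\<close> that also avoids \<open>x\<close>, since its
  intermediate vertices lie in the other colour class; together with \<open>a x b\<close> it would close a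
  cycle. Hence \<open>x\<close> separates \<open>u\<close> from \<open>y\<close>, no subgraph without cut vertices contains such a path
  \<open>u x y\<close>, and the vertices of every block are pairwise adjacent.
\<close>

section \<open>Walks as relation powers, and odd closed walks\<close>

lemma (in wf_digraph) awalk_iff_relpow:
  "(\<exists>p. awalk u p v \<and> length p = n) \<longleftrightarrow> u \<in> verts G \<and> (u, v) \<in> arcs_ends G ^^ n"
proof (induction n arbitrary: u)
  case 0
  show ?case by (auto simp: awalk_Nil_iff)
next
  case (Suc n)
  have "(\<exists>p. awalk u p v \<and> length p = Suc n) \<longleftrightarrow>
    (\<exists>e p. awalk u (e # p) v \<and> length p = n)"
    by (simp only: length_Suc_conv) blast
  also have "\<dots> \<longleftrightarrow>
    (\<exists>e. e \<in> arcs G \<and> tail G e = u \<and> (\<exists>p. awalk (head G e) p v \<and> length p = n))"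
    by (auto simp: awalk_Cons_iff)
  also have "\<dots> \<longleftrightarrow>
    (\<exists>w. (u, w) \<in> arcs_ends G \<and> (\<exists>p. awalk w p v \<and> length p = n))"
    by (auto simp: arcs_ends_conv)
  also have "\<dots> \<longleftrightarrow> (\<exists>w. (u, w) \<in> arcs_ends G \<and> (w, v) \<in> arcs_ends G ^^ n)"
    unfolding Suc.IH by (blast dest: adj_in_verts)
  also have "\<dots> \<longleftrightarrow> u \<in> verts G \<and> (u, v) \<in> arcs_ends G ^^ Suc n"
    by (auto simp: relpow_commute[symmetric] dest: adj_in_verts)
  finally show ?case .
qed

text \<open>A closed walk with a repeated vertex splits into two shorter closed walks. Their lengths
  add up to an odd number, so one of them is odd and induction on the length applies.\<close>

lemma (in wf_digraph) odd_closed_awalk_imp_odd_cycle: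
  assumes "awalk u p u" "odd (length p)"
  shows "\<exists>c. cycle c \<and> odd (length c)"
  using assms
proof (induction p arbitrary: u rule: length_induct)
  case (1 p)
  note IH = "1.IH"[rule_format] and p = "1.prems"
  from p obtain e es where p_eq: "p = e # es"
    by (cases p) auto
  with p have e: "e \<in> arcs G" "tail G e = u" and es: "awalk (head G e) es u"
    by (auto simp: awalk_Cons_iff)
  show ?case
  proof (cases "distinct (awalk_verts (head G e) es)")
    case True
    then have "cycle p"
      using p unfolding cycle_def p_eq by auto
    with p show ?thesis by blast
  next
    case False
    then obtain q r s w where split: "es = q @ r @ s" "0 < length r"
        "awalk (head G e) q w" "awalk w r w" "awalk w s u"
      using awalk_not_distinct_decomp[OF es] by blast
    show ?thesis
    proof (cases "odd (length r)")
      case True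
      then show ?thesis using IH[of r w] split by (simp add: p_eq)
    next
      case even: False
      have "awalk u (e # q @ s) u"
        using split e by (auto simp: awalk_Cons_iff intro: awalk_appendI)
      moreover have "length (e # q @ s) < length p" "odd (length (e # q @ s))"
        using split even p by (simp_all add: p_eq)
      ultimately show ?thesis using IH by blast
    qed
  qed
qed

section \<open>Vertex deletion and even walks in terms of relations\<close>

lemma arcs_ends_del_vert:
  "arcs_ends (pre_digraph.del_vert G v) = {(x, y) \<in> arcs_ends G. x \<noteq> v \<and> y \<noteq> v}"
  by (auto simp: arcs_ends_conv pre_digraph.del_vert_simps)

text \<open>An even walk lengthened by one edge at each end is again even. This moves a vertex along
  an edge while its reference vertex changes to a neighbour.\<close>

lemma relcomp_rtrancl_relcomp:
  assumes "(y, z) \<in> (R O R)\<^sup>*" "(x, y) \<in> R" "(z, w) \<in> R"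
  shows "(x, w) \<in> (R O R)\<^sup>*"
  using assms
proof (induction arbitrary: w rule: rtrancl_induct)
  case (step u z)
  then obtain m where "(x, m) \<in> (R O R)\<^sup>*" "(m, z) \<in> R" by blast
  with \<open>(z, w) \<in> R\<close> show ?case by (meson relcompI rtrancl_into_rtrancl)
qed blast

lemma rtrancl_relcomp_imp_even_relpow:
  assumes "(x, y) \<in> (R O R)\<^sup>*"
  shows "\<exists>n. even n \<and> (x, y) \<in> R ^^ n"
  using assms
proof (induction rule: rtrancl_induct)
  case base
  show ?case by (intro exI[of _ 0]) simp
next
  case (step y z)
  then obtain n where "even n" "(x, y) \<in> R ^^ n" by blast
  with step.hyps show ?case
    by (intro exI[of _ "Suc (Suc n)"]) auto
qed

lemma relpow_two: "R ^^ 2 = R O R"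
  by (simp add: numeral_2_eq_2)

section \<open>Forests: parity of walks, separation, and the exact-distance square\<close>

locale acyclic_graph = graph +
  assumes no_cycle: "\<not> (\<exists>p. cycle p \<and> 3 \<le> length p)"
begin

lemma closed_walk_even:
  assumes "(u, u) \<in> arcs_ends G ^^ n"
  shows "even n"
proof (rule ccontr)
  assume odd: "odd n"
  \<comment> \<open>A nontrivial walk is needed to place \<open>u\<close> in \<open>verts G\<close>:
    the zeroth power relates every \<open>u\<close> to itself.\<close>
  then have "(u, u) \<in> (arcs_ends G)\<^sup>+"
    using assms by (auto simp: trancl_power intro!: exI[of _ n] odd_pos)
  then have "u \<in> verts G" by (rule reachable1_in_verts)
  with assms obtain p where "awalk u p u" "length p = n"
    using awalk_iff_relpow by blast
  then obtain c where c: "cycle c" "odd (length c)"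
    using odd_closed_awalk_imp_odd_cycle odd by blast
  \<comment> \<open>The absence of loops rules out length 1, and a pair of opposite arcs is a cycle
    of even length, so an odd cycle has length at least 3.\<close>
  then have "2 \<le> length c" by (auto simp: cycle_digraph_conv)
  with c have "3 \<le> length c" by (cases "length c = 2") auto
  with c no_cycle show False by blast
qed

text \<open>An edge between the ends of an even walk would close it to an odd closed walk. This is
  the form in which bipartiteness is used below.\<close>

lemma even_walk_imp_not_adjacent:
  assumes "(x, y) \<in> (arcs_ends G O arcs_ends G)\<^sup>*"
  shows "(x, y) \<notin> arcs_ends G"
proof
  assume adj: "(x, y) \<in> arcs_ends G"
  from rtrancl_relcomp_imp_even_relpow[OF assms]
  obtain n where "even n" and n: "(x, y) \<in> arcs_ends G ^^ n" by (elim exE conjE)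
  have "(x, x) \<in> arcs_ends G ^^ Suc n"
    using n graph_symmetric[OF adj] by (rule relpow_Suc_I)
  with \<open>even n\<close> closed_walk_even[of x "Suc n"] show False by simp
qed

text \<open>A path from \<open>a\<close> to \<open>b\<close> avoiding \<open>z\<close> would close
  up through \<open>z\<close> to a cycle.\<close>

lemma neighbours_separated:
  assumes a: "(z, a) \<in> arcs_ends G" and b: "(z, b) \<in> arcs_ends G" and "a \<noteq> b"
  shows "\<not> a \<rightarrow>\<^sup>*\<^bsub>del_vert z\<^esub> b"
proof
  interpret del: wf_digraph "del_vert z" by (rule wf_digraph_del_vert)
  assume "a \<rightarrow>\<^sup>*\<^bsub>del_vert z\<^esub> b"
  then obtain p where p: "del.apath a p b"
    by (auto simp: del.reachable_apath)
  then have path: "apath a p b"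
    using subgraph_apath_imp_apath subgraph_del_vert by blast
  have "compatible (del_vert z) G"
    by (simp add: compatible_def del_vert_simps)
  then have verts: "awalk_verts a p = del.awalk_verts a p"
    by (simp add: compatible_awalk_verts)
  have "set (del.awalk_verts a p) \<subseteq> verts G - {z}"
    using p del.awalk_conv[of a p b] by (simp add: del.apath_def del_vert_simps)
  then have "z \<notin> set (awalk_verts a p)"
    unfolding verts by blast
  obtain e where e: "e \<in> arcs G" "tail G e = z" "head G e = a"
    using a by blast
  obtain f where f: "f \<in> arcs G" "tail G f = b" "head G f = z"
    using graph_symmetric[OF b] by blast
  have "awalk z (e # p @ [f]) z"
    using e f path by (auto simp: awalk_Cons_iff awalk_Nil_iff apath_def intro!: awalk_appendI)
  moreover have "awalk_verts a (p @ [f]) = awalk_verts a p @ [z]"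
    using path f
    by (subst awalk_verts_append)
      (auto simp: apath_def arc_def awalk_Cons_iff awalk_Nil_iff intro!: awalk_appendI arc_implies_awalk)
  ultimately have "cycle (e # p @ [f])"
    using path \<open>z \<notin> set (awalk_verts a p)\<close> e unfolding cycle_def apath_def by auto
  \<comment> \<open>Since \<open>a\<close> and \<open>b\<close> differ, the cycle is more than an
    edge traversed back and forth.\<close>
  moreover have "p \<noteq> []"
    using path \<open>a \<noteq> b\<close> by (auto simp: apath_Nil_iff)
  then have "3 \<le> length (e # p @ [f])"
    by (cases p) auto
  ultimately show False using no_cycle by blast
qed

lemma graph_dist_eq_2_iff:
  assumes x: "x \<in> verts G"
  shows "graph_dist G x y = 2 \<longleftrightarrow> x \<noteq> y \<and> (x, y) \<in> arcs_ends G O arcs_ends G"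
proof -
  have cost: "awalk_cost (\<lambda>_. 1) p = length p" for p
    by (induction p) auto
  have dist: "graph_dist G x y = (INF p\<in>{p. awalk x p y}. ereal (length p))"
    by (simp add: graph_dist_def \<mu>_def cost)
  have walk: "(\<exists>p. awalk x p y \<and> length p = n) \<longleftrightarrow> (x, y) \<in> arcs_ends G ^^ n" for n
    using awalk_iff_relpow x by simp
  show ?thesis
  proof
    assume d: "graph_dist G x y = 2"
    \<comment> \<open>A strict bound on the infimum yields an actual walk, of length at most
      2.\<close>
    then have "graph_dist G x y < ereal 3" by simp
    then obtain p where p: "awalk x p y" "length p < 3"
      by (auto simp: dist INF_less_iff)
    have ge: "2 \<le> length q" if "awalk x q y" for q
    proof -
      have "graph_dist G x y \<le> ereal (length q)"
        unfolding dist using that by (intro INF_lower) simp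
      then have "ereal 2 \<le> ereal (length q)" using d by simp
      then show ?thesis by simp
    qed
    have "length p = 2" using ge[OF p(1)] p(2) by simp
    then have "(x, y) \<in> arcs_ends G ^^ 2" using walk p by blast
    moreover have "x \<noteq> y"
      using ge[of "[]"] x by (auto simp: awalk_Nil_iff)
    ultimately show "x \<noteq> y \<and> (x, y) \<in> arcs_ends G O arcs_ends G"
      by (simp add: relpow_two)
  next
    assume xy: "x \<noteq> y \<and> (x, y) \<in> arcs_ends G O arcs_ends G"
    then obtain q where q: "awalk x q y" "length q = 2"
      using walk[of 2] by (auto simp: relpow_two)
    \<comment> \<open>Parity excludes a walk of length 1 here; in a triangle two adjacent vertices
      also have a common neighbour.\<close>
    have "(x, y) \<notin> arcs_ends G"
      using xy by (intro even_walk_imp_not_adjacent) blast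
    have ge: "2 \<le> length p" if "awalk x p y" for p
    proof (rule ccontr)
      assume "\<not> ?thesis"
      then consider "length p = 0" | "length p = 1" by linarith
      then show False
        using walk[of "length p"] that xy \<open>(x, y) \<notin> arcs_ends G\<close> by cases auto
    qed
    show "graph_dist G x y = 2"
      unfolding dist
    proof (rule antisym)
      show "(INF p\<in>{p. awalk x p y}. ereal (length p)) \<le> 2"
        using q by (intro INF_lower2[of q]) auto
      show "2 \<le> (INF p\<in>{p. awalk x p y}. ereal (length p))"
        using ge by (intro INF_greatest) force
    qed
  qed
qed

text \<open>The diagonal is removed because going along an edge and back is a walk of length
  2.\<close>

lemma parcs_exact_dist_square:
  "parcs (exact_dist_square G) = (arcs_ends G O arcs_ends G) - Id"
proof -
  have "(x, y) \<in> parcs (exact_dist_square G) \<longleftrightarrow>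
    x \<noteq> y \<and> (x, y) \<in> arcs_ends G O arcs_ends G" for x y
    using graph_dist_eq_2_iff[of x y]
    by (cases "x \<in> verts G") (auto simp: exact_dist_square_def dest: adj_in_verts)
  then show ?thesis by auto
qed

lemma pverts_exact_dist_square [simp]: "pverts (exact_dist_square G) = verts G"
  by (simp add: exact_dist_square_def)

lemma pair_graph_exact_dist_square: "pair_graph (exact_dist_square G)"
proof -
  have sub: "parcs (exact_dist_square G) \<subseteq> verts G \<times> verts G"
    by (auto simp: exact_dist_square_def)
  have "sym (parcs (exact_dist_square G))"
    unfolding parcs_exact_dist_square by (auto intro!: symI dest: graph_symmetric)
  moreover have "finite (parcs (exact_dist_square G))"
    using sub by (rule finite_subset) simp
  ultimately show ?thesis
    using sub by unfold_locales (auto simp: symmetric_def parcs_exact_dist_square)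
qed

lemma rtrancl_parcs_exact_dist_square:
  "(parcs (exact_dist_square G))\<^sup>* = (arcs_ends G O arcs_ends G)\<^sup>*"
  by (simp add: parcs_exact_dist_square rtrancl_r_diff_Id)

lemma exact_dist_square_separated:
  assumes ux: "(u, x) \<in> parcs (exact_dist_square G)" and xy: "(x, y) \<in> parcs (exact_dist_square G)"
    and "u \<noteq> y" "(u, y) \<notin> parcs (exact_dist_square G)"
  shows "\<not> u \<rightarrow>\<^sup>*\<^bsub>pre_digraph.del_vert (with_proj (exact_dist_square G)) x\<^esub> y"
proof
  interpret D: pair_graph "exact_dist_square G" by (rule pair_graph_exact_dist_square)
  interpret Dx: wf_digraph "D.del_vert x" by (rule D.wf_digraph_del_vert)
  interpret Tx: wf_digraph "del_vert x" by (rule wf_digraph_del_vert)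
  let ?E = "(arcs_ends G O arcs_ends G)\<^sup>*"
  have adj_del: "(v, w) \<in> arcs_ends (del_vert x)" if "(v, w) \<in> arcs_ends G" "v \<noteq> x" "w \<noteq> x" for v w
    using that by (simp add: arcs_ends_del_vert)
  from ux obtain a where a: "(u, a) \<in> arcs_ends G" "(a, x) \<in> arcs_ends G" "u \<noteq> x"
    by (auto simp: parcs_exact_dist_square)
  from xy obtain b where b: "(x, b) \<in> arcs_ends G" "(b, y) \<in> arcs_ends G" "x \<noteq> y"
    by (auto simp: parcs_exact_dist_square)
  \<comment> \<open>Otherwise \<open>u\<close> and \<open>y\<close> would have a common neighbour
    and be adjacent in the square.\<close>
  have "a \<noteq> b"
    using a b assms by (auto simp: parcs_exact_dist_square)
  have "a \<noteq> x" "b \<noteq> x"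
    using a b adj_not_same by blast+
  have "(x, u) \<in> ?E"
    using a graph_symmetric by blast
  assume "u \<rightarrow>\<^sup>*\<^bsub>D.del_vert x\<^esub> y"
  \<comment> \<open>The first conjunct records that the walk stays in the colour class of
    \<open>x\<close>. It keeps the middle vertex \<open>c\<close> of each expanded edge away from
    \<open>x\<close>, since \<open>c\<close> is adjacent to a vertex of that class.\<close>
  then have "(x, y) \<in> ?E \<and> a \<rightarrow>\<^sup>*\<^bsub>del_vert x\<^esub> y"
  proof (induction rule: Dx.reachable_induct)
    case base
    have "a \<rightarrow>\<^sup>*\<^bsub>del_vert x\<^esub> u"
      using adj_del a \<open>a \<noteq> x\<close> graph_symmetric by blast
    with \<open>(x, u) \<in> ?E\<close> show ?case by blast
  next
    case (step v w)
    then have "(v, w) \<in> parcs (exact_dist_square G)" "v \<noteq> x" "w \<noteq> x"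
      by (auto simp: arcs_ends_del_vert)
    then obtain c where c: "(v, c) \<in> arcs_ends G" "(c, w) \<in> arcs_ends G"
      by (auto simp: parcs_exact_dist_square)
    have "c \<noteq> x"
      using even_walk_imp_not_adjacent step.IH c graph_symmetric by blast
    then have "v \<rightarrow>\<^bsub>del_vert x\<^esub> c" "c \<rightarrow>\<^bsub>del_vert x\<^esub> w"
      using adj_del c \<open>v \<noteq> x\<close> \<open>w \<noteq> x\<close> by blast+
    then have "a \<rightarrow>\<^sup>*\<^bsub>del_vert x\<^esub> w"
      using step.IH by (blast intro: Tx.reachable_adj_trans)
    moreover have "(x, w) \<in> ?E"
      using step.IH c by (meson relcompI rtrancl.rtrancl_into_rtrancl)
    ultimately show ?case by blast
  qed
  moreover have "y \<rightarrow>\<^bsub>del_vert x\<^esub> b"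
    using adj_del b \<open>b \<noteq> x\<close> graph_symmetric by blast
  ultimately have "a \<rightarrow>\<^sup>*\<^bsub>del_vert x\<^esub> b"
    by (blast intro: Tx.reachable_adj_trans)
  then show False
    using neighbours_separated a b \<open>a \<noteq> b\<close> graph_symmetric by blast
qed

end

section \<open>Cut vertices, complete graphs and blocks\<close>

lemma subgraph_del_vert_mono:
  assumes "subgraph H G"
  shows "subgraph (pre_digraph.del_vert H v) (pre_digraph.del_vert G v)"
  using assms
  by (auto simp: subgraph_def compatible_def pre_digraph.del_vert_simps wf_digraph.wf_digraph_del_vert)

lemma (in graph) graph_induce_subgraph:
  assumes "S \<subseteq> verts G"
  shows "graph (G \<restriction> S)"
proof -
  have ind: "induced_subgraph (G \<restriction> S) G" using assms by auto
  interpret H: digraph "G \<restriction> S" using ind by (rule digraphI_induced)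
  show ?thesis
    using induced_graph_imp_symmetric[OF sym_arcs ind] by (rule H.graphI)
qed

lemma (in sym_digraph) connected_iff_strongly_connected:
  "connected G \<longleftrightarrow> strongly_connected G"
  using symmetric_connected_imp_strongly_connected[OF sym_arcs]
  by (auto simp: connected_def strongly_connected_def reachable_mk_symmetric_eq[OF sym_arcs])

lemma (in graph) graph_del_vert: "graph (del_vert v)"
proof -
  have "del_vert v = G \<restriction> (verts G - {v})"
    by (auto simp: del_vert_def induce_subgraph_def)
  then show ?thesis using graph_induce_subgraph by simp
qed

text \<open>A connected graph has one component, while \<open>u\<close> and \<open>y\<close> lie in
  different components after the deletion.\<close>

lemma (in graph) separated_imp_cut_vertex:
  assumes conn: "connected G" and x: "x \<in> verts G"
    and uy: "u \<in> verts G - {x}" "y \<in> verts G - {x}" "\<not> u \<rightarrow>\<^sup>*\<^bsub>del_vert x\<^esub> y"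
  shows "cut_vertex G x"
proof -
  interpret del: graph "del_vert x" by (rule graph_del_vert)
  have in_del: "u \<in> verts (del_vert x)" "y \<in> verts (del_vert x)"
    using uy by (simp_all add: del_vert_simps)
  have "del.scc_of u \<noteq> del.scc_of y"
    using uy del.in_scc_of_self[OF in_del(2)] by (auto simp: del.scc_of_def)
  then have "2 = card {del.scc_of u, del.scc_of y}" by simp
  also have "\<dots> \<le> card del.sccs_verts"
    using in_del by (intro card_mono del.finite_sccs_verts) (auto intro: del.scc_of_in_sccs_verts)
  finally have "2 \<le> card del.sccs" by (simp add: del.card_sccs_verts)
  moreover have "sccs = {G}"
    using conn connected_iff_strongly_connected strongly_connected_eq_iff by blast
  ultimately show ?thesis using x by (simp add: cut_vertex_def)
qed

lemma complete_graph_no_cut_vertex: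
  assumes G: "graph G" and adj: "\<And>u v. u \<in> verts G \<Longrightarrow> v \<in> verts G \<Longrightarrow> u \<noteq> v \<Longrightarrow> u \<rightarrow>\<^bsub>G\<^esub> v"
    and ne: "verts G \<noteq> {}"
  shows "connected G" "\<not> cut_vertex G v"
proof -
  interpret graph G by (rule G)
  interpret del: graph "del_vert v" by (rule graph_del_vert)
  have sc: "strongly_connected H" if "wf_digraph H" "verts H \<noteq> {}"
    "\<And>u v. u \<in> verts H \<Longrightarrow> v \<in> verts H \<Longrightarrow> u \<noteq> v \<Longrightarrow> u \<rightarrow>\<^bsub>H\<^esub> v" for H :: "('a, 'b) pre_digraph"
    using that by (metis strongly_connectedI wf_digraph.reachable_adjI wf_digraph.reachable_refl)
  have conn: "strongly_connected G" using sc adj ne wf_digraph by blast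
  then show "connected G" by (simp add: connected_iff_strongly_connected)
  have card_G: "card sccs = 1"
    using conn by (simp add: strongly_connected_eq_iff)
  have "card del.sccs \<le> 1"
  proof (cases "verts (del_vert v) = {}")
    \<comment> \<open>The graph was a single vertex or lost none of a nonempty set; strong
      connectivity demands a vertex, so an empty graph has no component.\<close>
    case True
    then have "del.sccs = {}"
      by (auto simp: del.sccs_def strongly_connected_def induced_subgraph_def subgraph_def)
    then show ?thesis by simp
  next
    case False
    have "strongly_connected (del_vert v)"
    proof (rule sc)
      fix x y assume "x \<in> verts (del_vert v)" "y \<in> verts (del_vert v)" "x \<noteq> y"
      then show "x \<rightarrow>\<^bsub>del_vert v\<^esub> y"
        using adj[of x y] by (simp add: arcs_ends_del_vert del_vert_simps)
    qed (use False del.wf_digraph in auto)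
    then show ?thesis by (simp add: del.strongly_connected_eq_iff)
  qed
  then show "\<not> cut_vertex G v" using card_G by (simp add: cut_vertex_def)
qed

text \<open>Along a walk in a block from \<open>u\<close>, the first vertex not adjacent to
  \<open>u\<close> would make its predecessor a cut vertex of the block. So the vertices of a block
  are pairwise adjacent in \<open>G\<close>.\<close>

lemma (in graph) clique_treeI:
  assumes conn: "connected G"
    and sep: "\<And>u x y. \<lbrakk>u \<rightarrow>\<^bsub>G\<^esub> x; x \<rightarrow>\<^bsub>G\<^esub> y; u \<noteq> y; \<not> u \<rightarrow>\<^bsub>G\<^esub> y\<rbrakk> \<Longrightarrow> \<not> u \<rightarrow>\<^sup>*\<^bsub>del_vert x\<^esub> y"
  shows "clique_tree G"
  unfolding clique_tree_def
proof (intro conjI allI impI)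
  show "graph G" by unfold_locales
  fix B assume "block B G"
  then have B: "graph B" "connected B" "\<And>v. \<not> cut_vertex B v" "subgraph B G"
    and max: "\<And>H. \<lbrakk>graph H; connected H; \<And>v. \<not> cut_vertex H v; subgraph B H; subgraph H G\<rbrakk> \<Longrightarrow> H = B"
    unfolding block_def max_subgraph_def by blast+
  interpret B: graph B by (rule B)
  have B_verts: "verts B \<subseteq> verts G" using B by auto
  have adj: "u \<rightarrow>\<^bsub>G\<^esub> v" if u: "u \<in> verts B" and v: "v \<in> verts B" and "u \<noteq> v" for u v
  proof -
    have "u \<rightarrow>\<^sup>*\<^bsub>B\<^esub> v"
      using B u v B.connected_iff_strongly_connected by auto
    then have "v = u \<or> u \<rightarrow>\<^bsub>G\<^esub> v"
    proof (induction rule: B.reachable_induct)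
      case (step x y)
      have xy: "x \<rightarrow>\<^bsub>G\<^esub> y" using step B adj_mono by blast
      show ?case
      proof (rule ccontr)
        assume y: "\<not> (y = u \<or> u \<rightarrow>\<^bsub>G\<^esub> y)"
        with step.IH xy have ux: "u \<rightarrow>\<^bsub>G\<^esub> x" by blast
        have "subgraph (B.del_vert x) (del_vert x)"
          using B by (intro subgraph_del_vert_mono)
        moreover have "\<not> u \<rightarrow>\<^sup>*\<^bsub>del_vert x\<^esub> y"
          using sep ux xy y by blast
        ultimately have "\<not> u \<rightarrow>\<^sup>*\<^bsub>B.del_vert x\<^esub> y"
          by (metis pre_digraph.reachable_mono)
        moreover have "u \<noteq> x" "y \<noteq> x"
          using ux xy adj_not_same by blast+
        ultimately have "cut_vertex B x"
          using B u B.adj_in_verts[OF step.hyps(2)] by (intro B.separated_imp_cut_vertex) auto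
        with B show False by blast
      qed
    qed blast
    with \<open>u \<noteq> v\<close> show ?thesis by blast
  qed
  \<comment> \<open>Adjacency is known in \<open>G\<close> only, and \<open>B\<close> might lack
    some of these edges. The induced graph is complete, hence has no cut vertex, and contains
    \<open>B\<close>; maximality makes them equal.\<close>
  let ?K = "G \<restriction> verts B"
  have K: "graph ?K" using B_verts by (rule graph_induce_subgraph)
  have K_adj: "u \<rightarrow>\<^bsub>?K\<^esub> v" if "u \<in> verts ?K" "v \<in> verts ?K" "u \<noteq> v" for u v
    using adj[of u v] that by (fastforce simp: arcs_ends_conv)
  have ne: "verts ?K \<noteq> {}"
    using B(2) by (auto simp: connected_def strongly_connected_def)
  have "?K = B"
    using complete_graph_no_cut_vertex[OF K K_adj ne] K B B_verts
    by (intro max) (auto intro: subgraph_induce_subgraphI2 subgraph_induce_subgraphI)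
  then have "u \<rightarrow>\<^bsub>B\<^esub> v" if "u \<in> verts B" "v \<in> verts B" "u \<noteq> v" for u v
    using K_adj that by simp
  then have "K\<^bsub>card (verts B)\<^esub> B"
    using B(1) by (auto simp: complete_digraph_def dest: B.adj_in_verts B.adj_not_same)
  then show "\<exists>n. K\<^bsub>n\<^esub> B" ..
qed (rule conn)

section \<open>The two components of the square of a tree\<close>

theorem theorem8:
  fixes T :: "('a,'b) pre_digraph"
  assumes "undirected_tree T"
    and "card (verts T) \<ge> 2"
  shows "card (pre_digraph.sccs (with_proj (exact_dist_square T))) = 2 \<and>
    (\<forall>C \<in> pre_digraph.sccs (with_proj (exact_dist_square T)). clique_tree C)"
proof
  interpret T: graph T using assms by (simp add: undirected_tree_def)
  interpret T: acyclic_graph T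
    using assms by unfold_locales (simp add: undirected_tree_def)
  interpret D: pair_graph "exact_dist_square T" by (rule T.pair_graph_exact_dist_square)
  have D: "graph (with_proj (exact_dist_square T))" by unfold_locales
  let ?R = "arcs_ends T"
  let ?E = "(?R O ?R)\<^sup>*"
  have conn: "u \<rightarrow>\<^sup>*\<^bsub>T\<^esub> v" if "u \<in> verts T" "v \<in> verts T" for u v
    using assms that T.connected_iff_strongly_connected
    by (auto simp: undirected_tree_def strongly_connected_def)
  obtain r w where rw: "r \<in> verts T" "w \<in> verts T" "r \<noteq> w"
    using assms(2) by (metis card_2_iff' card_le_Suc0_iff_eq not_less_eq_eq numeral_2_eq_2 T.finite_verts)
  \<comment> \<open>The ends of the edge \<open>r s\<close> represent the two colour
    classes.\<close>
  then obtain s where s: "(r, s) \<in> ?R"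
    using conn[of r w] by (auto elim: T.converse_reachable_cases)
  have "sym ?E"
    by (intro sym_rtrancl) (auto intro!: symI dest: T.graph_symmetric)
  have scc: "D.scc_of v = {w \<in> verts T. (v, w) \<in> ?E}" if "v \<in> verts T" for v
    using that \<open>sym ?E\<close>
    by (auto simp: D.scc_of_def D.reachable_conv T.rtrancl_parcs_exact_dist_square dest: symD)
  have scc_eq: "D.scc_of v = D.scc_of w" if "(v, w) \<in> ?E" "v \<in> verts T" "w \<in> verts T" for v w
    using that \<open>sym ?E\<close> by (auto simp: scc dest: symD intro: rtrancl_trans)
  \<comment> \<open>Each further edge of the walk exchanges the roles of \<open>r\<close> and
    \<open>s\<close>.\<close>
  have cover: "(r, v) \<in> ?E \<or> (s, v) \<in> ?E" if "v \<in> verts T" for v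
    using conn[OF rw(1) that]
  proof (induction rule: T.reachable_induct)
    case (step x y)
    have "(s, r) \<in> ?R" using s T.graph_symmetric by blast
    have "(q, y) \<in> ?E" if "(p, x) \<in> ?E" "(q, p) \<in> ?R" for p q
      using relcomp_rtrancl_relcomp that step.hyps(2) .
    then show ?case using step.IH s \<open>(s, r) \<in> ?R\<close> by blast
  qed blast
  have "s \<in> verts T" using s T.adj_in_verts by blast
  then have "D.sccs_verts = {D.scc_of r, D.scc_of s}"
    using rw cover scc_eq by (auto simp: D.sccs_verts_conv_scc_of)
  moreover have "D.scc_of r \<noteq> D.scc_of s"
  proof
    assume eq: "D.scc_of r = D.scc_of s"
    have "s \<in> D.scc_of s" using \<open>s \<in> verts T\<close> by (simp add: scc)
    then have "(r, s) \<in> ?E" unfolding eq[symmetric] scc[OF rw(1)] by blast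
    with s T.even_walk_imp_not_adjacent show False by blast
  qed
  ultimately show "card D.sccs = 2"
    by (simp flip: D.card_sccs_verts)
  show "\<forall>C\<in>D.sccs. clique_tree C"
  proof
    fix C assume "C \<in> D.sccs"
    then have C: "induced_subgraph C (with_proj (exact_dist_square T))" "strongly_connected C"
      by (auto simp: D.sccs_def)
    interpret C: graph C
      using C D by (metis D.digraphI_induced D.sym_arcs digraph.graphI induced_graph_imp_symmetric)
    \<comment> \<open>As \<open>C\<close> is induced, vertices not adjacent in \<open>C\<close> are
      not adjacent in the square either, which the separation result requires.\<close>
    have arcs_C: "(u, v) \<in> arcs_ends C \<longleftrightarrow>
      u \<in> verts C \<and> v \<in> verts C \<and> (u, v) \<in> parcs (exact_dist_square T)" for u v
      using C(1) by (force simp: induced_subgraph_def subgraph_def compatible_def arcs_ends_conv)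
    show "clique_tree C"
    proof (rule C.clique_treeI)
      show "connected C" using C(2) by (simp add: C.connected_iff_strongly_connected)
      fix u x y
      assume "(u, x) \<in> arcs_ends C" "(x, y) \<in> arcs_ends C" "u \<noteq> y" "(u, y) \<notin> arcs_ends C"
      then have "\<not> u \<rightarrow>\<^sup>*\<^bsub>D.del_vert x\<^esub> y"
        using T.exact_dist_square_separated by (simp add: arcs_C)
      moreover have "subgraph (C.del_vert x) (D.del_vert x)"
        using C(1) by (intro subgraph_del_vert_mono) (simp add: induced_subgraph_def)
      ultimately show "\<not> u \<rightarrow>\<^sup>*\<^bsub>C.del_vert x\<^esub> y"
        by (metis pre_digraph.reachable_mono)
    qed
  qed
qed

end
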